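(* Let $n\geq 2$ and let $S_1,S_2,\dots,S_{n+2}$ be hyperspheres in $n$-dimensional Euclidean space $E^n$. These hyperspheres can be endowed with coorientations such that $\det D=0$, where $D$ is the $(n+2)\times(n+2)$ matrix with entries $D_{ij}=\tau(S_i,S_j)$, if and only if at least one of the following holds: the hyperspheres $S_1,\dots,S_{n+2}$ (i) share a common tangent hypersphere or hyperplane (that is, there is a hypersphere or hyperplane that is tangent or equal to each $S_i$), (ii) share a common intersection point, or (iii) are all orthogonal to one hypersphere or hyperplane and equally inclined (in the unoriented sense) to another hypersphere or hyperplane.
   Context: A cooriented hypersphere in $E^n$ is a (metric, positive radius) hypersphere $S$ together with a sign $\varepsilon\in\{\pm1\}$, where $\varepsilon=1$ stands for the outward unit normal vector field and $\varepsilon=-1$ for the inward one. For cooriented hyperspheres $S_i,S_j$ with centres $c_i,c_j$, radii $r_i,r_j$, and coorientations $\varepsilon_i,\varepsilon_j$, define $$\tau(S_i,S_j)=\varepsilon_i\varepsilon_j\bigl(|c_i-c_j|^2-(r_i-\varepsilon_i\varepsilon_jr_j)^2\bigr).$$ In (iii), the two hyperspheres/hyperplanes are distinct; "equally inclined" means that every $S_i$ intersects the second hypersphere or hyperplane non-tangentially (and is not equal to it), at a common unoriented angle $\theta$, i.e. $|\cos\theta|$ is the same number in $[0,1)$ for all $i$. *)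

theory Defs
  imports "HOL-Analysis.Analysis"
begin

definition hypersphere :: "'a::euclidean_space set \<Rightarrow> bool" where
  "hypersphere T \<longleftrightarrow> (\<exists>c r. 0 < r \<and> T = sphere c r)"

definition hyperplane :: "'a::euclidean_space set \<Rightarrow> bool" where
  "hyperplane T \<longleftrightarrow> (\<exists>a b. a \<noteq> 0 \<and> T = {x. a \<bullet> x = b})"

text \<open>A cooriented hypersphere is given by its centre \<open>c\<close>, radius \<open>r\<close> and sign \<open>e\<close>
  (\<open>1\<close> for the outward and \<open>-1\<close> for the inward unit normal field).\<close>

definition tau :: "'a::euclidean_space \<times> real \<times> real \<Rightarrow> 'a \<times> real \<times> real \<Rightarrow> real" where
  "tau = (\<lambda>(c, r, e) (c', r', e'). e * e' * ((norm (c - c'))\<^sup>2 - (r - e * e' * r')\<^sup>2))"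

text \<open>\<open>u\<close> is one of the two unit normals of the hypersphere or hyperplane \<open>T\<close> at \<open>p \<in> T\<close>;
  false for all other sets \<open>T\<close>.\<close>

definition unit_normal_at :: "'a::euclidean_space set \<Rightarrow> 'a \<Rightarrow> 'a \<Rightarrow> bool" where
  "unit_normal_at T p u \<longleftrightarrow> p \<in> T \<and> norm u = 1 \<and>
     ((\<exists>c r. 0 < r \<and> T = sphere c r \<and> (\<exists>t. u = t *\<^sub>R (p - c))) \<or>
      (\<exists>a b. a \<noteq> 0 \<and> T = {x. a \<bullet> x = b} \<and> (\<exists>t. u = t *\<^sub>R a)))"

text \<open>Tangency is contact of distinct sets: their tangent hyperplanes at some common point
  coincide.\<close>

definition tangent :: "'a::euclidean_space set \<Rightarrow> 'a set \<Rightarrow> bool" where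
  "tangent S T \<longleftrightarrow> S \<noteq> T \<and> (\<exists>p u. unit_normal_at S p u \<and> unit_normal_at T p u)"

text \<open>The unoriented angle, in \<open>[0, \<pi>/2]\<close>, is the same at all common points. Requiring the
  set of angles to be a singleton also forces \<open>S\<close> and \<open>T\<close> to intersect.\<close>

definition meet_at_angle :: "'a::euclidean_space set \<Rightarrow> 'a set \<Rightarrow> real \<Rightarrow> bool" where
  "meet_at_angle S T \<theta> \<longleftrightarrow>
     {arccos \<bar>u \<bullet> v\<bar> | p u v. unit_normal_at S p u \<and> unit_normal_at T p v} = {\<theta>}"

definition orthogonal_to :: "'a::euclidean_space set \<Rightarrow> 'a set \<Rightarrow> bool" where
  "orthogonal_to S T \<longleftrightarrow> meet_at_angle S T (pi / 2)"

definition equally_inclined :: "('i \<Rightarrow> 'a::euclidean_space set) \<Rightarrow> 'a set \<Rightarrow> bool" where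
  "equally_inclined S T \<longleftrightarrow>
     (\<exists>\<theta>. \<forall>i. S i \<noteq> T \<and> \<not> tangent (S i) T \<and> meet_at_angle (S i) T \<theta>)"

end

theory Submission
  imports Defs
begin

text \<open>The proof passes to Lie sphere geometry. A hypersphere or hyperplane is the zero set of
  \<open>a * \<bar>x\<bar>\<^sup>2 - 2 * (c \<bullet> x) + q\<close>, and its coefficient vector \<open>(a, q, c)\<close> is taken in the Lorentzian space
  of signature \<open>(n + 1, 1)\<close> with form \<open>lor\<close>; the vectors of square \<open>1\<close> represent exactly the
  hyperspheres and hyperplanes. At every common point of two of them the unit normals
  \<open>a p - c\<close> have inner product \<open>lor\<close> (\<open>inner_normal_normal\<close>), so contact, orthogonality and inclination
  become conditions \<open>\<bar>lor\<bar> = 1\<close>, \<open>lor = 0\<close> and \<open>\<bar>lor\<bar> = k < 1\<close>. Dimension at least two enters when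
  \<open>\<bar>lor\<bar> \<le> 1\<close> has to produce a common point (\<open>sphere_meets_locus\<close>).

  One more, negative, coordinate records the coorientation. In the resulting space of dimension
  \<open>n + 3\<close> and signature \<open>(n + 1, 2)\<close>, with form \<open>lie\<close>, a cooriented hypersphere is an isotropic vector
  \<open>lie_vec\<close>, and \<open>tau\<close> is \<open>-2\<close> times \<open>lie\<close>. Thus \<open>D\<close> is a Gram matrix of \<open>n + 2\<close> vectors in a space of
  dimension \<open>n + 3\<close>, and it is singular for one of two reasons: the span \<open>W\<close> of the vectors contains
  a nonzero vector orthogonal to all of \<open>W\<close>, or the vectors are linearly dependent.

  A nonzero isotropic vector of the orthogonal complement of \<open>W\<close> is a common tangent hypersphere or
  hyperplane if its last coordinate is nonzero, and a common point otherwise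
  (\<open>isotropic_orthogonal_cases\<close>). If the vectors are dependent, the complement has dimension at
  least two. If it contains no nonzero isotropic vector it is definite, and it cannot be negative
  definite, since then \<open>W\<close> would be positive definite although it contains isotropic vectors
  (\<open>not_two_negative\<close>). So it contains two orthogonal positive vectors, one of them with last
  coordinate zero (\<open>isotropic_or_positive_pair\<close>); these are the orthogonal and the equally inclined
  hypersphere or hyperplane (\<open>positive_pair_to_pencil\<close>).

  Conversely, each of the three conditions gives vectors of the complement for a suitable choice of
  signs: either a nonzero isotropic \<open>v\<close>, and then independence would force \<open>W\<close> to be the whole
  hyperplane orthogonal to \<open>v\<close>, which contains \<open>v\<close>; or two linearly independent vectors, and then
  \<open>W\<close> has dimension at most \<open>n + 1\<close>.\<close>

section \<open>Hyperspheres and hyperplanes as vectors of a Lorentzian space\<close>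

definition lor :: "real \<times> real \<times> 'a::euclidean_space \<Rightarrow> real \<times> real \<times> 'a \<Rightarrow> real" where
  "lor = (\<lambda>(a, q, c) (a', q', c'). c \<bullet> c' - (a * q' + a' * q) / 2)"

definition locus :: "real \<times> real \<times> 'a::euclidean_space \<Rightarrow> 'a set" where
  "locus = (\<lambda>(a, q, c). {x. a * (x \<bullet> x) - 2 * (c \<bullet> x) + q = 0})"

definition normal :: "real \<times> real \<times> 'a::euclidean_space \<Rightarrow> 'a \<Rightarrow> 'a" where
  "normal = (\<lambda>(a, q, c) p. a *\<^sub>R p - c)"

definition sphere_vec :: "'a::euclidean_space \<Rightarrow> real \<Rightarrow> real \<times> real \<times> 'a" where
  "sphere_vec c r = (1 / r) *\<^sub>R (1, c \<bullet> c - r\<^sup>2, c)"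

text \<open>The two equations of \<open>p\<close> express \<open>c \<bullet> p\<close> and \<open>c' \<bullet> p\<close> through \<open>p \<bullet> p\<close>, and then every term containing
  \<open>p\<close> cancels. So the angle of intersection is the same at all common points.\<close>
lemma inner_normal_normal:
  assumes "p \<in> locus v" "p \<in> locus w"
  shows "normal v p \<bullet> normal w p = lor v w"
proof -
  obtain a q c where v: "v = (a, q, c)" by (metis prod_cases3)
  obtain a' q' c' where w: "w = (a', q', c')" by (metis prod_cases3)
  have 1: "c \<bullet> p = (a * (p \<bullet> p) + q) / 2" "c' \<bullet> p = (a' * (p \<bullet> p) + q') / 2"
    using assms by (auto simp: v w locus_def)
  show ?thesis
    by (simp add: v w normal_def lor_def inner_diff inner_commute[of p c'] 1) (simp add: field_simps)
qed

lemma norm_normal: "lor v v = 1 \<Longrightarrow> p \<in> locus v \<Longrightarrow> norm (normal v p) = 1"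
  using inner_normal_normal[of p v v] by (simp add: norm_eq_1)

lemma sphere_vec_lor [simp]: "r \<noteq> 0 \<Longrightarrow> lor (sphere_vec c r) (sphere_vec c r) = 1"
  by (simp add: sphere_vec_def lor_def field_simps power2_eq_square)

lemma mem_sphere_inner:
  assumes "0 \<le> r"
  shows "x \<in> sphere c r \<longleftrightarrow> x \<bullet> x - 2 * (c \<bullet> x) + (c \<bullet> c - r\<^sup>2) = 0"
proof -
  have "x \<in> sphere c r \<longleftrightarrow> (norm (x - c))\<^sup>2 = r\<^sup>2"
    using assms by (auto simp: dist_norm norm_minus_commute)
  then show ?thesis
    by (simp add: power2_norm_eq_inner inner_diff inner_commute[of x c] algebra_simps)
qed

lemma locus_scaleR: "k \<noteq> 0 \<Longrightarrow> locus (k *\<^sub>R v) = locus v"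
proof -
  assume k: "k \<noteq> 0"
  obtain a q c where v: "v = (a, q, c)" by (metis prod_cases3)
  have "k * a * (x \<bullet> x) - 2 * (k * (c \<bullet> x)) + k * q = k * (a * (x \<bullet> x) - 2 * (c \<bullet> x) + q)" for x
    by (simp add: algebra_simps)
  then show ?thesis using k by (simp add: v locus_def)
qed

lemma locus_sphere_vec: "0 < r \<Longrightarrow> locus (sphere_vec c r) = sphere c r"
  unfolding sphere_vec_def
  by (subst locus_scaleR, simp, rule set_eqI, subst mem_sphere_inner) (auto simp: locus_def)

lemma locus_eq_sphere:
  assumes "lor (a, q, c) (a, q, c) = 1" "a \<noteq> 0"
  shows "locus (a, q, c) = sphere (c /\<^sub>R a) (1 / \<bar>a\<bar>)"
proof -
  let ?b = "c /\<^sub>R a"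
  have "c \<bullet> c - a * q = 1" using assms by (simp add: lor_def)
  then have "q / a = ?b \<bullet> ?b - (1 / \<bar>a\<bar>)\<^sup>2"
    using assms(2) by (simp add: power2_eq_square field_simps)
  moreover have "locus (a, q, c) = locus (1, q / a, ?b)"
    using locus_scaleR[OF assms(2), of "(1, q / a, ?b)"] assms(2) by simp
  ultimately show ?thesis
    by (intro set_eqI, subst mem_sphere_inner) (auto simp: locus_def)
qed

lemma hypersphere_or_hyperplane_iff:
  "hypersphere T \<or> hyperplane T \<longleftrightarrow> (\<exists>v. lor v v = 1 \<and> T = locus v)"
proof
  assume "hypersphere T \<or> hyperplane T"
  then show "\<exists>v. lor v v = 1 \<and> T = locus v"
  proof
    assume "hypersphere T"
    then obtain c r where "0 < r" "T = sphere c r" by (auto simp: hypersphere_def)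
    then show ?thesis
      by (intro exI[of _ "sphere_vec c r"]) (simp add: locus_sphere_vec)
  next
    assume "hyperplane T"
    then obtain a b where a: "a \<noteq> 0" and T: "T = {x. a \<bullet> x = b}" by (auto simp: hyperplane_def)
    have "lor (0, 2 * b / norm a, a /\<^sub>R norm a) (0, 2 * b / norm a, a /\<^sub>R norm a) = 1"
      using a by (simp add: lor_def dot_square_norm power2_eq_square field_simps)
    moreover have "T = locus (0, 2 * b / norm a, a /\<^sub>R norm a)"
      using a by (auto simp: T locus_def field_simps)
    ultimately show ?thesis by blast
  qed
next
  assume "\<exists>v. lor v v = 1 \<and> T = locus v"
  then obtain a q c where v: "lor (a, q, c) (a, q, c) = 1" "T = locus (a, q, c)"
    by (metis prod_cases3)
  show "hypersphere T \<or> hyperplane T"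
  proof (cases "a = 0")
    case True
    then have "c \<noteq> 0" "T = {x. c \<bullet> x = q / 2}"
      using v by (auto simp: lor_def locus_def)
    then show ?thesis unfolding hyperplane_def by blast
  next
    case False
    then have "T = sphere (c /\<^sub>R a) (1 / \<bar>a\<bar>)" "0 < 1 / \<bar>a\<bar>"
      using locus_eq_sphere v by auto
    then show ?thesis unfolding hypersphere_def by blast
  qed
qed

text \<open>If the centres differ, the two points in which the line of centres meets the first sphere have
  different distances from the other centre.\<close>
lemma sphere_centre_unique:
  fixes c :: "'a::euclidean_space"
  assumes "0 < r" "sphere c r = sphere c' r'"
  shows "c = c'"
proof (rule ccontr)
  assume ne: "c \<noteq> c'"
  define D where "D = norm (c' - c)"
  define d where "d = (c' - c) /\<^sub>R D"
  have D: "D > 0" using ne by (simp add: D_def)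
  have nd: "norm d = 1" using D by (simp add: d_def D_def)
  have c': "c' = c + D *\<^sub>R d" using D by (simp add: d_def)
  have "c + r *\<^sub>R d \<in> sphere c r" "c - r *\<^sub>R d \<in> sphere c r"
    using nd assms(1) by (simp_all add: dist_norm)
  then have "norm (c' - (c + r *\<^sub>R d)) = r'" "norm (c' - (c - r *\<^sub>R d)) = r'"
    unfolding assms(2) by (simp_all add: dist_norm)
  moreover have "c' - (c + r *\<^sub>R d) = (D - r) *\<^sub>R d" "c' - (c - r *\<^sub>R d) = (D + r) *\<^sub>R d"
    by (simp_all add: c' algebra_simps)
  ultimately have "\<bar>D - r\<bar> = \<bar>D + r\<bar>" using nd by simp
  then show False using D assms(1) by linarith
qed

lemma hyperplane_normal_unique:
  fixes c :: "'a::euclidean_space"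
  assumes "norm c = 1" "{x. a \<bullet> x = b} = {x. c \<bullet> x = k}"
  shows "a = (a \<bullet> c) *\<^sub>R c"
proof -
  define d where "d = a - (a \<bullet> c) *\<^sub>R c"
  have cc: "c \<bullet> c = 1" using assms(1) by (simp add: norm_eq_1)
  have cd: "c \<bullet> d = 0" by (simp add: d_def inner_diff cc inner_commute)
  \<comment> \<open>Translation by a direction \<open>d\<close> orthogonal to \<open>c\<close> preserves the hyperplane.\<close>
  have "k *\<^sub>R c \<in> {x. c \<bullet> x = k}" "k *\<^sub>R c + d \<in> {x. c \<bullet> x = k}"
    by (simp_all add: inner_add cc cd)
  then have "a \<bullet> d = 0" unfolding assms(2)[symmetric] by (simp add: inner_add)
  then have "d \<bullet> d = 0" using cd by (simp add: d_def inner_diff inner_commute)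
  then show ?thesis by (simp add: d_def)
qed

lemma unit_multiple_cases:
  assumes "norm u = 1" "norm w = 1" "u = t *\<^sub>R w"
  shows "u = w \<or> u = - w"
proof -
  have "\<bar>t\<bar> = 1" using assms by simp
  then have "t = 1 \<or> t = -1" by linarith
  then show ?thesis using assms(3) by auto
qed

text \<open>The predicate on the left asks for some presentation of the set as a sphere or a hyperplane, so
  the proof shows that the presentation is unique up to scaling. Spheres are bounded and,
  in dimension at least two, hyperplanes are not.\<close>
lemma unit_normal_locus:
  fixes v :: "real \<times> real \<times> 'a::euclidean_space"
  assumes dim: "2 \<le> DIM('a)" and v: "lor v v = 1"
  shows "unit_normal_at (locus v) p u \<longleftrightarrow> p \<in> locus v \<and> (u = normal v p \<or> u = - normal v p)"
proof (cases "p \<in> locus v")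
  case False
  then show ?thesis by (simp add: unit_normal_at_def)
next
  case p: True
  obtain a q c where v': "v = (a, q, c)" by (metis prod_cases3)
  have nn: "norm (normal v p) = 1" using norm_normal v p by blast
  have not_both: "sphere z s \<noteq> {x. b \<bullet> x = k}" if "b \<noteq> 0" for z b :: 'a and s k
    using bounded_hyperplane_eq_trivial[of b k] dim that bounded_sphere[of z s] by force
  show ?thesis
  proof (cases "a = 0")
    case True
    then have g: "normal v p = - c" by (simp add: v' normal_def)
    then have nc: "norm c = 1" using nn by simp
    then have c0: "c \<noteq> 0" by auto
    have l: "locus v = {x. c \<bullet> x = q / 2}" by (auto simp: v' True locus_def)
    show ?thesis
    proof
      assume u: "unit_normal_at (locus v) p u"
      then obtain b k t where b: "b \<noteq> 0" "{x. c \<bullet> x = q / 2} = {x. b \<bullet> x = k}" "u = t *\<^sub>R b"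
        unfolding unit_normal_at_def l using not_both[OF c0] by metis
      have "b = (b \<bullet> c) *\<^sub>R c" using hyperplane_normal_unique[OF nc] b(2) by metis
      then have "u = (t * (b \<bullet> c)) *\<^sub>R c" using b(3) by (metis scaleR_scaleR)
      moreover have "norm u = 1" using u by (simp add: unit_normal_at_def)
      ultimately have "u = c \<or> u = - c" using nc unit_multiple_cases by blast
      then show "p \<in> locus v \<and> (u = normal v p \<or> u = - normal v p)" using p g by auto
    next
      assume "p \<in> locus v \<and> (u = normal v p \<or> u = - normal v p)"
      then have u: "u = (-1) *\<^sub>R c \<or> u = 1 *\<^sub>R c" using g by auto
      then have "norm u = 1" using nc by auto
      then show "unit_normal_at (locus v) p u"
        using p c0 u unfolding unit_normal_at_def l by blast
    qed
  next
    case False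
    have l: "locus v = sphere (c /\<^sub>R a) (1 / \<bar>a\<bar>)"
      using locus_eq_sphere False v v' by blast
    have r: "0 < 1 / \<bar>a\<bar>" using False by simp
    have g: "p - c /\<^sub>R a = (1 / a) *\<^sub>R normal v p" "normal v p = a *\<^sub>R (p - c /\<^sub>R a)"
      using False by (simp_all add: v' normal_def algebra_simps inverse_eq_divide)
    show ?thesis
    proof
      assume u: "unit_normal_at (locus v) p u"
      then obtain z s t where z: "sphere (c /\<^sub>R a) (1 / \<bar>a\<bar>) = sphere z s" "u = t *\<^sub>R (p - z)"
        unfolding unit_normal_at_def l using not_both by metis
      have "z = c /\<^sub>R a" using sphere_centre_unique[OF r z(1)] by simp
      then have "u = (t / a) *\<^sub>R normal v p" using z(2) g(1) by simp
      moreover have "norm u = 1" using u by (simp add: unit_normal_at_def)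
      ultimately have "u = normal v p \<or> u = - normal v p" using nn unit_multiple_cases by blast
      then show "p \<in> locus v \<and> (u = normal v p \<or> u = - normal v p)" using p by auto
    next
      assume u: "p \<in> locus v \<and> (u = normal v p \<or> u = - normal v p)"
      then have "u = a *\<^sub>R (p - c /\<^sub>R a) \<or> u = (-a) *\<^sub>R (p - c /\<^sub>R a)"
        using g(2) by (metis scaleR_minus_left)
      moreover have "norm u = 1" using u nn by auto
      ultimately show "unit_normal_at (locus v) p u"
        using p r unfolding unit_normal_at_def l by blast
    qed
  qed
qed

lemma unit_vector_on_hyperplane:
  fixes g :: "'a::euclidean_space"
  assumes dim: "2 \<le> DIM('a)" and s: "s\<^sup>2 \<le> g \<bullet> g"
  obtains w where "norm w = 1" "g \<bullet> w = s"
proof (cases "g = 0")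
  case True
  obtain w :: 'a where "norm w = 1" using vector_choose_size zero_le_one by metis
  then show ?thesis using that[of w] True s by simp
next
  case False
  obtain h0 :: 'a where h0: "h0 \<noteq> 0" "orthogonal g h0"
    using orthogonal_to_vector_exists[OF dim] by metis
  define h where "h = h0 /\<^sub>R norm h0"
  have h: "g \<bullet> h = 0" "h \<bullet> h = 1"
    using h0 by (auto simp: h_def orthogonal_def dot_square_norm power2_eq_square)
  define G where "G = g \<bullet> g"
  have G: "G > 0" using False by (simp add: G_def)
  define k where "k = sqrt (1 - s\<^sup>2 / G)"
  have k: "k\<^sup>2 = 1 - s\<^sup>2 / G" using s G by (simp add: k_def G_def)
  define w where "w = (s / G) *\<^sub>R g + k *\<^sub>R h"
  have "w \<bullet> w = (s / G)\<^sup>2 * G + k\<^sup>2"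
    using h by (simp add: w_def inner_add G_def power2_eq_square inner_commute[of h g])
  also have "\<dots> = 1" using G unfolding k by (simp add: field_simps power2_eq_square)
  finally have "norm w = 1" by (simp add: norm_eq_1)
  moreover have "g \<bullet> w = s" using G h by (simp add: w_def inner_add G_def[symmetric])
  ultimately show ?thesis using that by blast
qed

text \<open>A point \<open>c + r w\<close> of the sphere lies on \<open>locus (a, q, b)\<close> if and only if \<open>g \<bullet> w = L - a r\<close>, where
  \<open>g = a c - b\<close> and \<open>L\<close> is the value of \<open>lor\<close>. Since \<open>g \<bullet> g = (L - a r)\<^sup>2 + (1 - L\<^sup>2)\<close>, a unit vector \<open>w\<close> of
  this kind exists as soon as \<open>\<bar>L\<bar> \<le> 1\<close>. The other direction is the Cauchy-Schwarz inequality for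
  the normals.\<close>
lemma sphere_meets_locus:
  fixes c :: "'a::euclidean_space"
  assumes dim: "2 \<le> DIM('a)" and r: "0 < r" and v: "lor v v = 1"
  shows "sphere c r \<inter> locus v \<noteq> {} \<longleftrightarrow> \<bar>lor (sphere_vec c r) v\<bar> \<le> 1"
proof
  assume "sphere c r \<inter> locus v \<noteq> {}"
  then obtain p where p: "p \<in> locus (sphere_vec c r)" "p \<in> locus v"
    unfolding locus_sphere_vec[OF r] by blast
  then show "\<bar>lor (sphere_vec c r) v\<bar> \<le> 1"
    using Cauchy_Schwarz_ineq2[of "normal (sphere_vec c r) p" "normal v p"] r v
    by (simp add: inner_normal_normal norm_normal)
next
  obtain a q b where v': "v = (a, q, b)" by (metis prod_cases3)
  define L where "L = lor (sphere_vec c r) v"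
  assume "\<bar>lor (sphere_vec c r) v\<bar> \<le> 1"
  then have L1: "L\<^sup>2 \<le> 1" by (simp add: L_def abs_le_square_iff[of _ 1, simplified])
  have bb: "b \<bullet> b = 1 + a * q" using v by (simp add: v' lor_def)
  have rL: "2 * r * L = 2 * (b \<bullet> c) - (q + a * (c \<bullet> c - r\<^sup>2))"
    using r by (simp add: L_def v' lor_def sphere_vec_def inner_commute field_simps)
  define g where "g = a *\<^sub>R c - b"
  have "g \<bullet> g = a * (a * (c \<bullet> c) - 2 * (b \<bullet> c) + q) + 1"
    by (simp add: g_def inner_diff inner_commute[of c b] bb algebra_simps)
  also have "a * (c \<bullet> c) - 2 * (b \<bullet> c) + q = a * r\<^sup>2 - 2 * r * L"
    using rL by (simp add: algebra_simps)
  finally have "g \<bullet> g = (L - a * r)\<^sup>2 + (1 - L\<^sup>2)"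
    by (simp add: algebra_simps power2_eq_square)
  then have "(L - a * r)\<^sup>2 \<le> g \<bullet> g" using L1 by simp
  then obtain w where w: "norm w = 1" "g \<bullet> w = L - a * r"
    using unit_vector_on_hyperplane[OF dim] by metis
  have ww: "w \<bullet> w = 1" using w(1) by (simp add: norm_eq_1)
  have bw: "b \<bullet> w = a * (c \<bullet> w) - L + a * r" using w(2) by (simp add: g_def inner_diff)
  have "a * ((c + r *\<^sub>R w) \<bullet> (c + r *\<^sub>R w)) - 2 * (b \<bullet> (c + r *\<^sub>R w)) + q
      = a * (c \<bullet> c) - 2 * (b \<bullet> c) + q - (a * r\<^sup>2 - 2 * r * L)"
    by (simp add: inner_add inner_commute[of w b] inner_commute[of w c] ww bw algebra_simps power2_eq_square)
  also have "\<dots> = 0" using rL by (simp add: algebra_simps)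
  finally have "c + r *\<^sub>R w \<in> locus v" by (simp add: v' locus_def)
  moreover have "c + r *\<^sub>R w \<in> sphere c r" using w r by (simp add: dist_norm)
  ultimately show "sphere c r \<inter> locus v \<noteq> {}" by blast
qed

lemma unit_inner_eq_1:
  fixes u w :: "'a::real_inner"
  assumes "norm u = 1" "norm w = 1" "\<bar>u \<bullet> w\<bar> = 1"
  shows "u = w \<or> u = - w"
proof -
  have "u \<bullet> w = 1 \<or> u \<bullet> w = -1" using assms(3) by linarith
  moreover have "u \<bullet> u = 1" "w \<bullet> w = 1" using assms by (simp_all add: norm_eq_1)
  ultimately have "(u - w) \<bullet> (u - w) = 0 \<or> (u + w) \<bullet> (u + w) = 0"
    by (auto simp: inner_diff inner_add inner_commute)
  then show ?thesis by (auto simp: eq_neg_iff_add_eq_0)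
qed

text \<open>Unit vectors with inner product \<open>1\<close> or \<open>-1\<close> are equal up to sign, so \<open>\<bar>lor\<bar> = 1\<close> means that the
  normals at a common point coincide up to sign. Equality of the two sets is the case of contact
  that the definition of tangency leaves out.\<close>
lemma tangent_or_eq_iff:
  fixes c :: "'a::euclidean_space"
  assumes dim: "2 \<le> DIM('a)" and r: "0 < r" and v: "lor v v = 1"
  shows "tangent (sphere c r) (locus v) \<or> sphere c r = locus v
    \<longleftrightarrow> \<bar>lor (sphere_vec c r) v\<bar> = 1"
proof -
  let ?s = "sphere_vec c r"
  have s: "lor ?s ?s = 1" "sphere c r = locus ?s" using r by (simp_all add: locus_sphere_vec)
  note un = unit_normal_locus[OF dim s(1)] unit_normal_locus[OF dim v]
  have common: "\<bar>lor ?s v\<bar> = 1"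
    if "unit_normal_at (locus ?s) p u" "unit_normal_at (locus v) p u" for p u
  proof -
    have p: "p \<in> locus ?s" "p \<in> locus v" "norm u = 1"
      using that by (auto simp: unit_normal_at_def)
    have "u = normal ?s p \<or> u = - normal ?s p" "u = normal v p \<or> u = - normal v p"
      using that un by blast+
    then have "normal ?s p = u \<or> normal ?s p = - u" "normal v p = u \<or> normal v p = - u"
      by (metis minus_minus)+
    then have "\<bar>normal ?s p \<bullet> normal v p\<bar> = 1" using p(3) by (auto simp: norm_eq_1)
    then show ?thesis using inner_normal_normal[OF p(1,2)] by simp
  qed
  show ?thesis
  proof
    assume A: "tangent (sphere c r) (locus v) \<or> sphere c r = locus v"
    have "\<exists>p u. unit_normal_at (locus ?s) p u \<and> unit_normal_at (locus v) p u"
    proof (cases "sphere c r = locus v")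
      case True
      obtain p where "p \<in> sphere c r" using sphere_eq_empty r
        by (metis DIM_positive ex_in_conv not_less_iff_gr_or_eq)
      then have "unit_normal_at (locus ?s) p (normal ?s p)" unfolding s(2) using un by auto
      then show ?thesis using True s(2) by metis
    next
      case False
      then show ?thesis using A s(2) by (auto simp: tangent_def)
    qed
    then show "\<bar>lor ?s v\<bar> = 1" using common by blast
  next
    assume L: "\<bar>lor ?s v\<bar> = 1"
    then obtain p where p: "p \<in> locus ?s" "p \<in> locus v"
      using sphere_meets_locus[OF dim r v, of c] s(2) by auto
    have "normal ?s p = normal v p \<or> normal ?s p = - normal v p"
      using unit_inner_eq_1 L inner_normal_normal[OF p] norm_normal[OF s(1) p(1)]
        norm_normal[OF v p(2)] by metis
    then have "unit_normal_at (locus ?s) p (normal v p)" "unit_normal_at (locus v) p (normal v p)"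
      using un p by auto
    then show "tangent (sphere c r) (locus v) \<or> sphere c r = locus v"
      unfolding tangent_def s(2) by blast
  qed
qed

lemma meet_at_angle_iff:
  fixes c :: "'a::euclidean_space"
  assumes dim: "2 \<le> DIM('a)" and r: "0 < r" and v: "lor v v = 1"
  shows "meet_at_angle (sphere c r) (locus v) \<theta>
    \<longleftrightarrow> \<bar>lor (sphere_vec c r) v\<bar> \<le> 1 \<and> \<theta> = arccos \<bar>lor (sphere_vec c r) v\<bar>"
proof -
  let ?s = "sphere_vec c r"
  have s: "lor ?s ?s = 1" "sphere c r = locus ?s" using r by (simp_all add: locus_sphere_vec)
  note un = unit_normal_locus[OF dim s(1)] unit_normal_locus[OF dim v]
  let ?A = "{arccos \<bar>u \<bullet> w\<bar> | p u w. unit_normal_at (locus ?s) p u \<and> unit_normal_at (locus v) p w}"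
  have "?A = {arccos \<bar>lor ?s v\<bar> | p. p \<in> locus ?s \<inter> locus v}" (is "_ = ?B")
  proof (intro equalityI subsetI)
    fix x assume "x \<in> ?A"
    then obtain p u w where x: "x = arccos \<bar>u \<bullet> w\<bar>" and p: "p \<in> locus ?s" "p \<in> locus v"
      and "u = normal ?s p \<or> u = - normal ?s p" "w = normal v p \<or> w = - normal v p"
      using un by auto
    then have "\<bar>u \<bullet> w\<bar> = \<bar>normal ?s p \<bullet> normal v p\<bar>" by auto
    then show "x \<in> ?B" using x p inner_normal_normal[OF p] by auto
  next
    fix x assume "x \<in> ?B"
    then obtain p where x: "x = arccos \<bar>lor ?s v\<bar>" and p: "p \<in> locus ?s" "p \<in> locus v" by auto
    then have "unit_normal_at (locus ?s) p (normal ?s p)" "unit_normal_at (locus v) p (normal v p)"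
      using un by auto
    then show "x \<in> ?A" using x inner_normal_normal[OF p] by force
  qed
  then have "meet_at_angle (sphere c r) (locus v) \<theta> \<longleftrightarrow> ?B = {\<theta>}"
    by (simp only: meet_at_angle_def s(2))
  also have "\<dots> \<longleftrightarrow> locus ?s \<inter> locus v \<noteq> {} \<and> \<theta> = arccos \<bar>lor ?s v\<bar>" by auto
  finally show ?thesis using sphere_meets_locus[OF dim r v, of c] s(2) by simp
qed

lemma arccos_abs_eq_iff:
  "\<bar>x\<bar> \<le> 1 \<Longrightarrow> \<bar>y\<bar> \<le> 1 \<Longrightarrow> arccos \<bar>x\<bar> = arccos \<bar>y\<bar> \<longleftrightarrow> \<bar>x\<bar> = \<bar>y\<bar>"
  by (rule arccos_eq_iff) simp

lemma orthogonal_to_iff: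
  fixes c :: "'a::euclidean_space"
  assumes dim: "2 \<le> DIM('a)" and r: "0 < r" and v: "lor v v = 1"
  shows "orthogonal_to (sphere c r) (locus v) \<longleftrightarrow> lor (sphere_vec c r) v = 0"
proof -
  let ?L = "lor (sphere_vec c r) v"
  have "\<bar>?L\<bar> \<le> 1 \<Longrightarrow> pi / 2 = arccos \<bar>?L\<bar> \<longleftrightarrow> ?L = 0"
    using arccos_abs_eq_iff[of 0 ?L] by (simp only: arccos_0 abs_zero) auto
  then show ?thesis
    unfolding orthogonal_to_def meet_at_angle_iff[OF assms] by (cases "?L = 0") auto
qed

lemma equally_inclined_iff:
  fixes c :: "'i \<Rightarrow> 'a::euclidean_space"
  assumes dim: "2 \<le> DIM('a)" and r: "\<And>i. 0 < r i" and v: "lor v v = 1"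
  shows "equally_inclined (\<lambda>i. sphere (c i) (r i)) (locus v)
    \<longleftrightarrow> (\<exists>k. 0 \<le> k \<and> k < 1 \<and> (\<forall>i. \<bar>lor (sphere_vec (c i) (r i)) v\<bar> = k))"
proof -
  let ?L = "\<lambda>i. lor (sphere_vec (c i) (r i)) v"
  have "equally_inclined (\<lambda>i. sphere (c i) (r i)) (locus v)
      \<longleftrightarrow> (\<exists>\<theta>. \<forall>i. \<bar>?L i\<bar> < 1 \<and> \<theta> = arccos \<bar>?L i\<bar>)"
  proof -
    have "sphere (c i) (r i) \<noteq> locus v \<and> \<not> tangent (sphere (c i) (r i)) (locus v)
        \<and> meet_at_angle (sphere (c i) (r i)) (locus v) \<theta>
        \<longleftrightarrow> \<bar>?L i\<bar> < 1 \<and> \<theta> = arccos \<bar>?L i\<bar>" for i \<theta>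
      using tangent_or_eq_iff[OF dim r v, of "c i" i] meet_at_angle_iff[OF dim r v, of "c i" i \<theta>]
      by auto
    then show ?thesis by (simp add: equally_inclined_def)
  qed
  also have "\<dots> \<longleftrightarrow> (\<exists>k. 0 \<le> k \<and> k < 1 \<and> (\<forall>i. \<bar>?L i\<bar> = k))"
  proof
    assume "\<exists>\<theta>. \<forall>i. \<bar>?L i\<bar> < 1 \<and> \<theta> = arccos \<bar>?L i\<bar>"
    then obtain \<theta> where \<theta>: "\<And>i. \<bar>?L i\<bar> < 1" "\<And>i. \<theta> = arccos \<bar>?L i\<bar>" by blast
    then have "\<bar>?L i\<bar> = \<bar>?L undefined\<bar>" for i
      using arccos_abs_eq_iff[of "?L i" "?L undefined"] by (metis less_imp_le)
    then show "\<exists>k. 0 \<le> k \<and> k < 1 \<and> (\<forall>i. \<bar>?L i\<bar> = k)"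
      using \<theta>(1) by (intro exI[of _ "\<bar>?L undefined\<bar>"]) auto
  next
    assume "\<exists>k. 0 \<le> k \<and> k < 1 \<and> (\<forall>i. \<bar>?L i\<bar> = k)"
    then obtain k where "k < 1" "\<And>i. \<bar>?L i\<bar> = k" by blast
    then show "\<exists>\<theta>. \<forall>i. \<bar>?L i\<bar> < 1 \<and> \<theta> = arccos \<bar>?L i\<bar>" by (intro exI[of _ "arccos k"]) auto
  qed
  finally show ?thesis .
qed

section \<open>Singular Gram matrices\<close>

definition combination :: "('m::finite \<Rightarrow> 'v::real_vector) \<Rightarrow> real ^ 'm \<Rightarrow> 'v" where
  "combination x l = (\<Sum>j\<in>UNIV. (l $ j) *\<^sub>R x j)"

lemma linear_combination: "linear (combination x)"
  by (rule linearI)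
    (simp_all add: combination_def scaleR_add_left sum.distrib scaleR_sum_right)

lemma range_combination: "range (combination x) = span (range x)"
proof
  show "range (combination x) \<subseteq> span (range x)"
    unfolding combination_def image_subset_iff
    by (intro ballI span_sum span_scale) (simp add: span_base)
  have "x k = combination x (axis k 1)" for k
    by (simp add: combination_def axis_def if_distrib[of "\<lambda>t. t *\<^sub>R _"] cong: if_cong)
  then have "range x \<subseteq> range (combination x)" by blast
  then show "span (range x) \<subseteq> range (combination x)"
    by (rule span_minimal) (intro linear_subspace_image linear_combination subspace_UNIV)
qed

lemma dim_range_less_iff:
  fixes x :: "'m::finite \<Rightarrow> 'v::euclidean_space"
  shows "dim (range x) < CARD('m) \<longleftrightarrow> (\<exists>l. l \<noteq> 0 \<and> combination x l = 0)"
proof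
  assume less: "dim (range x) < CARD('m)"
  have "\<not> inj (combination x)"
  proof
    assume "inj (combination x)"
    then have "dim (range (combination x)) = dim (UNIV :: (real ^ 'm) set)"
      by (intro dim_image_eq linear_combination) (auto intro: inj_on_subset)
    then show False using less by (simp add: range_combination)
  qed
  then show "\<exists>l. l \<noteq> 0 \<and> combination x l = 0"
    using linear_injective_0[OF linear_combination[of x]] by auto
next
  assume "\<exists>l. l \<noteq> 0 \<and> combination x l = 0"
  then obtain l k where l: "combination x l = 0" "l $ k \<noteq> 0" by (auto simp: vec_eq_iff)
  let ?B = "x ` (- {k})"
  have "(l $ k) *\<^sub>R x k = - (\<Sum>j\<in>-{k}. (l $ j) *\<^sub>R x j)"
    using l(1) sum.remove[of UNIV k "\<lambda>j. (l $ j) *\<^sub>R x j"]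
    by (simp add: combination_def Compl_eq_Diff_UNIV eq_neg_iff_add_eq_0)
  moreover have "- (\<Sum>j\<in>-{k}. (l $ j) *\<^sub>R x j) \<in> span ?B"
    by (intro span_neg span_sum span_scale) (simp add: span_base)
  ultimately have "(l $ k) *\<^sub>R x k \<in> span ?B" by metis
  then have xk: "x k \<in> span ?B"
    using l(2) span_scale[of "(l $ k) *\<^sub>R x k" ?B "inverse (l $ k)"] by simp
  have "x j \<in> span ?B" for j
  proof (cases "j = k")
    case False
    then show ?thesis by (intro span_base imageI) simp
  qed (use xk in simp)
  then have "range x \<subseteq> span ?B" by blast
  then have "dim (range x) \<le> card ?B" by (intro dim_le_card) auto
  also have "\<dots> \<le> card (- {k} :: 'm set)" by (rule card_image_le) simp
  also have "\<dots> < CARD('m)" by (rule psubset_card_mono) auto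
  finally show "dim (range x) < CARD('m)" .
qed

lemma det_gram_eq_0_iff:
  fixes x :: "'m::finite \<Rightarrow> 'v::euclidean_space"
  assumes J: "linear J"
  shows "det (\<chi> i j. x i \<bullet> J (x j)) = 0
    \<longleftrightarrow> (\<exists>l. l \<noteq> 0 \<and> (\<forall>i. x i \<bullet> J (combination x l) = 0))"
proof -
  let ?G = "(\<chi> i j. x i \<bullet> J (x j)) :: real ^ 'm ^ 'm"
  have "?G *v l = (\<chi> i. x i \<bullet> J (combination x l))" for l
    by (simp add: matrix_vector_mult_def combination_def linear_sum[OF J] linear_cmul[OF J]
        inner_sum_right mult.commute vec_eq_iff)
  moreover have "det ?G \<noteq> 0 \<longleftrightarrow> (\<forall>l. ?G *v l = 0 \<longrightarrow> l = 0)"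
    using invertible_det_nz[of ?G] invertible_left_inverse[of ?G] matrix_left_invertible_ker[of ?G]
    by simp
  ultimately show ?thesis by (auto simp: vec_eq_iff)
qed

text \<open>A kernel vector of the Gram matrix gives a combination \<open>v\<close> orthogonal to all \<open>x i\<close>, hence to itself;
  either \<open>v\<close> is nonzero or it is a linear dependency.\<close>
lemma singular_gram_cases:
  fixes x :: "'m::finite \<Rightarrow> 'v::euclidean_space"
  assumes J: "linear J" and "det (\<chi> i j. x i \<bullet> J (x j)) = 0"
  shows "(\<exists>v. v \<noteq> 0 \<and> v \<bullet> J v = 0 \<and> (\<forall>i. x i \<bullet> J v = 0)) \<or> dim (range x) < CARD('m)"
proof -
  obtain l where l: "l \<noteq> 0" "\<And>i. x i \<bullet> J (combination x l) = 0"
    using assms(2) unfolding det_gram_eq_0_iff[OF J] by blast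
  let ?v = "combination x l"
  have "?v \<bullet> J ?v = (\<Sum>j\<in>UNIV. (l $ j) * (x j \<bullet> J ?v))"
    unfolding combination_def[of x l] inner_sum_left by simp
  then have "?v \<bullet> J ?v = 0" by (simp add: l)
  then show ?thesis using l dim_range_less_iff[of x] by blast
qed

lemma singular_gram_if_dependent:
  fixes x :: "'m::finite \<Rightarrow> 'v::euclidean_space"
  assumes J: "linear J" and "dim (range x) < CARD('m)"
  shows "det (\<chi> i j. x i \<bullet> J (x j)) = 0"
  using assms(2) unfolding det_gram_eq_0_iff[OF J] dim_range_less_iff
  by (auto simp: linear_0[OF J])

lemma span_eq_hyperplane:
  fixes x :: "'m::finite \<Rightarrow> 'v::euclidean_space"
  assumes "CARD('m) + 1 = DIM('v)" "\<not> dim (range x) < CARD('m)"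
    and "a \<noteq> 0" "\<And>i. a \<bullet> x i = 0"
  shows "span (range x) = {y. a \<bullet> y = 0}"
proof (rule subspace_dim_equal)
  show "span (range x) \<subseteq> {y. a \<bullet> y = 0}"
    by (rule span_minimal) (use assms(4) in \<open>auto simp: subspace_hyperplane\<close>)
  show "dim {y. a \<bullet> y = 0} \<le> dim (span (range x))"
    using assms by (simp add: dim_hyperplane)
qed (auto simp: subspace_hyperplane)

text \<open>Independent \<open>x i\<close> would span the whole hyperplane orthogonal to \<open>v\<close>. It contains \<open>v\<close>, whose
  coefficients then form a kernel vector of the Gram matrix.\<close>
lemma singular_gram_if_isotropic:
  fixes x :: "'m::finite \<Rightarrow> 'v::euclidean_space"
  assumes J: "linear J" "inj J" "\<And>u w. u \<bullet> J w = w \<bullet> J u"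
    and card: "CARD('m) + 1 = DIM('v)"
    and v: "v \<noteq> 0" "v \<bullet> J v = 0" "\<And>i. x i \<bullet> J v = 0"
  shows "det (\<chi> i j. x i \<bullet> J (x j)) = 0"
proof (cases "dim (range x) < CARD('m)")
  case True
  then show ?thesis using singular_gram_if_dependent J(1) by blast
next
  case False
  have "J v \<noteq> 0" using J v(1) linear_injective_0 by blast
  then have "span (range x) = {y. J v \<bullet> y = 0}"
    using span_eq_hyperplane[OF card False] v(3) by (simp add: inner_commute)
  then have "v \<in> range (combination x)"
    using v(2) by (simp add: range_combination inner_commute)
  then obtain l where "v = combination x l" by blast
  then show ?thesis
    unfolding det_gram_eq_0_iff[OF J(1)] using v linear_0[OF linear_combination] by metis
qed

text \<open>Otherwise the span would be a hyperplane, and its normal \<open>a\<close> would be unique up to scaling.\<close>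
lemma dependent_if_two_normals:
  fixes x :: "'m::finite \<Rightarrow> 'v::euclidean_space"
  assumes card: "CARD('m) + 1 = DIM('v)"
    and a: "a \<noteq> 0" "\<And>i. a \<bullet> x i = 0" and b: "\<And>i. b \<bullet> x i = 0" "\<And>k. b \<noteq> k *\<^sub>R a"
  shows "dim (range x) < CARD('m)"
proof (rule ccontr)
  assume "\<not> dim (range x) < CARD('m)"
  then have eq: "span (range x) = {y. a \<bullet> y = 0}" using span_eq_hyperplane card a by blast
  have sub: "span (range x) \<subseteq> {y. b \<bullet> y = 0}"
    by (rule span_minimal) (use b in \<open>auto simp: subspace_hyperplane\<close>)
  define k where "k = (b \<bullet> a) / (a \<bullet> a)"
  let ?d = "b - k *\<^sub>R a"
  have ad: "a \<bullet> ?d = 0" using a(1) by (simp add: k_def inner_diff_right inner_commute)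
  then have "b \<bullet> ?d = 0" using eq sub by blast
  then have "?d \<bullet> ?d = 0" using ad by (simp add: inner_diff_left[of b])
  then show False using b(2)[of k] by simp
qed

section \<open>The Lie form\<close>

definition lie :: "(real \<times> real \<times> 'a::euclidean_space) \<times> real
    \<Rightarrow> (real \<times> real \<times> 'a) \<times> real \<Rightarrow> real" where
  "lie x y = lor (fst x) (fst y) - snd x * snd y"

text \<open>The operator that represents \<open>lie\<close> with respect to the Euclidean inner product. It carries the
  facts about Gram matrices and Euclidean orthogonal complements over to the indefinite form.\<close>
definition dual :: "(real \<times> real \<times> 'a::euclidean_space) \<times> real \<Rightarrow> (real \<times> real \<times> 'a) \<times> real" where
  "dual = (\<lambda>((a, q, c), s). ((- q / 2, - a / 2, c), - s))"

lemma inner_dual: "x \<bullet> dual y = lie x y"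
  by (cases x rule: prod.exhaust, cases "fst x" rule: prod_cases3,
      cases y rule: prod.exhaust, cases "fst y" rule: prod_cases3)
    (simp add: dual_def lie_def lor_def field_simps)

lemma linear_dual: "linear dual"
  by (rule linearI) (auto simp: dual_def field_simps)

lemma inj_dual: "inj dual"
  by (rule injI) (auto simp: dual_def)

lemma surj_dual: "surj dual"
proof (rule surjI)
  show "dual ((\<lambda>((a, q, c), s). ((- 2 * q, - 2 * a, c), - s)) y) = y" for y :: "(real \<times> real \<times> 'a) \<times> real"
    by (auto simp: dual_def split: prod.splits)
qed

lemma lie_commute: "lie x y = lie y x"
  by (auto simp: lie_def lor_def inner_commute mult.commute split: prod.splits)

lemma lie_right: "lie x (y + z) = lie x y + lie x z" "lie x (y - z) = lie x y - lie x z"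
  "lie x (k *\<^sub>R y) = k * lie x y"
  by (simp_all add: inner_dual[symmetric] linear_add[OF linear_dual] linear_diff[OF linear_dual]
      linear_cmul[OF linear_dual] inner_add_right inner_diff_right)

lemma lie_left: "lie (y + z) x = lie y x + lie z x" "lie (y - z) x = lie y x - lie z x"
  "lie (k *\<^sub>R y) x = k * lie y x"
  by (simp_all add: lie_commute[of _ x] lie_right)

lemma lor_scaleR_right: "lor v (k *\<^sub>R w) = k * lor v w"
  using lie_right(3)[of "(v, 0)" k "(w, 0)"] by (simp add: lie_def)

lemma lor_commute: "lor v w = lor w v"
  using lie_commute[of "(v, 0)" "(w, 0)"] by (simp add: lie_def)

lemma lor_scaleR_left: "lor (k *\<^sub>R v) w = k * lor v w"
  by (simp add: lor_commute[of _ w] lor_scaleR_right)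

lemma orthogonal_exists:
  fixes S :: "((real \<times> real \<times> 'a::euclidean_space) \<times> real) set"
  assumes "dim S < DIM('a) + 3"
  obtains v where "v \<noteq> 0" "\<And>x. x \<in> S \<Longrightarrow> lie x v = 0"
proof -
  have "dim S < DIM((real \<times> real \<times> 'a) \<times> real)" using assms by simp
  then obtain y where y: "y \<noteq> 0" "\<And>x. x \<in> span S \<Longrightarrow> orthogonal y x"
    using orthogonal_to_subspace_exists by blast
  obtain v where v: "y = dual v" using surj_dual by (metis surj_def)
  then have "v \<noteq> 0" using y(1) linear_0[OF linear_dual] by auto
  moreover have "lie x v = 0" if "x \<in> S" for x
    using y(2)[OF span_base[OF that]] by (simp add: v orthogonal_def inner_commute inner_dual[symmetric])
  ultimately show ?thesis using that by blast
qed

text \<open>With \<open>q = - a\<close> the form is \<open>\<bar>c\<bar>\<^sup>2 + a\<^sup>2\<close>: the negative directions of \<open>lie\<close> are \<open>a = q\<close> and the last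
  coordinate.\<close>
lemma lie_nonneg:
  fixes w :: "real \<times> real \<times> 'a::euclidean_space"
  assumes "fst w + fst (snd w) = 0"
  shows "0 \<le> lie (w, 0) (w, 0)"
proof -
  obtain a q c where w: "w = (a, q, c)" by (metis prod_cases3)
  have "q = - a" using assms by (simp add: w)
  then show ?thesis by (simp add: w lie_def lor_def)
qed

text \<open>The form has only two negative directions. So two orthogonal negative vectors \<open>t\<close>, \<open>u\<close> leave a
  positive definite complement, which contains no isotropic \<open>x\<close>. Concretely, a combination \<open>w\<close> of
  \<open>x\<close>, \<open>u\<close> and \<open>t\<close> is chosen in which both negative coordinates, \<open>snd w\<close> and \<open>h w\<close>, vanish; it has
  nonnegative square by \<open>lie_nonneg\<close>, whereas orthogonality makes its square negative.\<close>
lemma not_two_negative: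
  assumes t: "snd t = 0" "lie t t < 0" and u: "lie u u < 0" and tu: "lie t u = 0"
    and x: "lie x x = 0" "lie x t = 0" "lie x u = 0" "snd x \<noteq> 0"
  shows False
proof -
  define h where "h = (\<lambda>v :: (real \<times> real \<times> 'a) \<times> real. fst (fst v) + fst (snd (fst v)))"
  have h: "h (y - z) = h y - h z" "h (k *\<^sub>R y) = k * h y" for y z k
    by (simp_all add: h_def algebra_simps)
  have "h t \<noteq> 0"
    using lie_nonneg[of "fst t"] t by (auto simp: h_def prod_eq_iff) (metis not_less prod.collapse)
  define y where "y = snd u *\<^sub>R x - snd x *\<^sub>R u"
  define w where "w = y - (h y / h t) *\<^sub>R t"
  have "snd w = 0" "h w = 0" using t(1) \<open>h t \<noteq> 0\<close> by (simp_all add: w_def y_def h)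
  then have "0 \<le> lie w w"
    using lie_nonneg[of "fst w"] by (metis h_def prod.collapse)
  moreover have "lie y y = (snd x)\<^sup>2 * lie u u"
    using x lie_commute[of u x] by (simp add: y_def lie_left lie_right power2_eq_square)
  moreover have "lie y t = 0" "lie t y = 0"
    using x tu lie_commute[of u t] lie_commute[of t x] by (simp_all add: y_def lie_left lie_right)
  then have "lie w w = lie y y + (h y / h t)\<^sup>2 * lie t t"
    by (simp add: w_def lie_left lie_right power2_eq_square)
  moreover have "(snd x)\<^sup>2 * lie u u < 0" using x(4) u by (simp add: mult_pos_neg)
  moreover have "(h y / h t)\<^sup>2 * lie t t \<le> 0" using t(2) by (simp add: mult_nonneg_nonpos)
  ultimately show False by linarith
qed

lemma isotropic_of_opposite_signs:
  assumes "lie t u = 0" "lie t t * lie u u < 0"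
  obtains k where "t + k *\<^sub>R u \<noteq> 0" "lie (t + k *\<^sub>R u) (t + k *\<^sub>R u) = 0"
proof -
  \<comment> \<open>The root of \<open>lie t t + k\<^sup>2 * lie u u = 0\<close>.\<close>
  define k where "k = sqrt (- lie t t / lie u u)"
  have nz: "lie u u \<noteq> 0" "lie t t \<noteq> 0" using assms(2) by auto
  have "0 \<le> - lie t t / lie u u"
    using assms(2) by (auto simp: mult_less_0_iff divide_le_0_iff)
  then have "k\<^sup>2 = - lie t t / lie u u" by (simp add: k_def)
  moreover have "lie (t + k *\<^sub>R u) (t + k *\<^sub>R u) = lie t t + k\<^sup>2 * lie u u"
    using assms(1) lie_commute[of u t] by (simp add: lie_left lie_right power2_eq_square)
  ultimately have "lie (t + k *\<^sub>R u) (t + k *\<^sub>R u) = 0" using nz by simp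
  moreover have "lie t (t + k *\<^sub>R u) \<noteq> 0" using assms(1) nz by (simp add: lie_right)
  then have "t + k *\<^sub>R u \<noteq> 0" by (metis lie_right(3) mult_zero_left scaleR_zero_left)
  ultimately show ?thesis using that by blast
qed

text \<open>The dimension bound leaves room for one additional orthogonality condition. It is spent first on
  \<open>(0, 1)\<close>, which makes the last coordinate of \<open>t\<close> vanish, and then on \<open>t\<close> itself, which gives \<open>u\<close>. The
  signs of the two squares decide the rest.\<close>
lemma isotropic_or_positive_pair:
  fixes x :: "'m::finite \<Rightarrow> (real \<times> real \<times> 'a::euclidean_space) \<times> real"
  assumes dim: "dim (range x) < DIM('a) + 2"
    and x: "lie (x j) (x j) = 0" "snd (x j) \<noteq> 0"
  shows "(\<exists>v. v \<noteq> 0 \<and> lie v v = 0 \<and> (\<forall>i. lie (x i) v = 0)) \<or>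
    (\<exists>t u. snd t = 0 \<and> 0 < lie t t \<and> 0 < lie u u \<and> lie t u = 0 \<and>
      (\<forall>i. lie (x i) t = 0) \<and> (\<forall>i. lie (x i) u = 0))"
proof -
  have ins: "dim (insert y (range x)) < DIM('a) + 3" for y
    using dim by (simp add: dim_insert)
  obtain t where t: "t \<noteq> 0" "\<And>y. y \<in> insert (0, 1) (range x) \<Longrightarrow> lie y t = 0"
    using orthogonal_exists[OF ins] by blast
  have "lie (0, 1) t = - snd t" by (simp add: lie_def lor_def zero_prod_def split: prod.splits)
  then have t0: "snd t = 0" using t(2) by simp
  obtain u where u: "u \<noteq> 0" "\<And>y. y \<in> insert t (range x) \<Longrightarrow> lie y u = 0"
    using orthogonal_exists[OF ins] by blast
  have xt: "lie (x i) t = 0" and xu: "lie (x i) u = 0" for i using t(2) u(2) by simp_all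
  have tu: "lie t u = 0" using u(2) by simp
  consider "lie t t = 0" | "lie u u = 0" | "lie t t * lie u u < 0"
    | "lie t t < 0" "lie u u < 0" | "lie t t > 0" "lie u u > 0"
    by (metis linorder_neqE_linordered_idom mult_neg_pos mult_pos_neg)
  then show ?thesis
  proof cases
    case 3
    then obtain k where "t + k *\<^sub>R u \<noteq> 0" "lie (t + k *\<^sub>R u) (t + k *\<^sub>R u) = 0"
      using isotropic_of_opposite_signs tu by metis
    moreover have "lie (x i) (t + k *\<^sub>R u) = 0" for i by (simp add: lie_right xt xu)
    ultimately show ?thesis by blast
  next
    case 4
    then show ?thesis using not_two_negative[OF t0 _ _ tu x(1) xt xu x(2)] by blast
  qed (use t u xt xu tu t0 in blast)+
qed

section \<open>Cooriented hyperspheres\<close>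

text \<open>The usual Lie coordinates of the cooriented hypersphere with signed radius \<open>e r\<close> are
  \<open>(1, \<bar>c\<bar>\<^sup>2 - r\<^sup>2, c)\<close> together with \<open>e r\<close>. Here they are multiplied by \<open>e\<close>, which absorbs the prefactor
  \<open>e e'\<close> of \<open>tau\<close>; so the last coordinate is \<open>r\<close>.\<close>
definition lie_vec :: "'a::euclidean_space \<Rightarrow> real \<Rightarrow> real \<Rightarrow> (real \<times> real \<times> 'a) \<times> real" where
  "lie_vec c r e = ((e * r) *\<^sub>R sphere_vec c r, r)"

lemma tau_eq_lie:
  assumes "0 < r" "0 < r'" "e \<in> {1, -1}" "e' \<in> {1, -1}"
  shows "tau (c, r, e) (c', r', e') = - 2 * lie (lie_vec c r e) (lie_vec c' r' e')"
proof -
  have n: "(norm (c - c'))\<^sup>2 = c \<bullet> c - 2 * (c \<bullet> c') + c' \<bullet> c'"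
    by (simp add: power2_norm_eq_inner inner_diff inner_commute[of c' c])
  show ?thesis
    using assms unfolding tau_def prod.case n
    by (auto simp: lie_def lor_def lie_vec_def sphere_vec_def
        power2_eq_square field_simps)
qed

lemma lie_lie_vec_eq_0:
  assumes "0 < r" "e \<in> {1, -1}"
  shows "lie (lie_vec c r e) (v, k) = 0 \<longleftrightarrow> lor (sphere_vec c r) v = e * k"
proof -
  have "lie (lie_vec c r e) (v, k) = r * (e * lor (sphere_vec c r) v - k)"
    by (simp add: lie_def lie_vec_def lor_scaleR_left algebra_simps)
  then show ?thesis using assms by auto
qed

lemma mem_sphere_iff_lor:
  assumes "0 < r"
  shows "p \<in> sphere c r \<longleftrightarrow> lor (sphere_vec c r) (1, p \<bullet> p, p) = 0"
proof -
  have "lor (sphere_vec c r) (1, p \<bullet> p, p)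
      = - ((p \<bullet> p - 2 * (c \<bullet> p) + (c \<bullet> c - r\<^sup>2)) / (2 * r))"
    using assms by (simp add: sphere_vec_def lor_def field_simps)
  then show ?thesis
    using assms mem_sphere_inner[of r p c] by (simp only: neg_equal_0_iff_equal) simp
qed

text \<open>Write \<open>v = (w, k)\<close>. For \<open>k\<close> nonzero, \<open>w / k\<close> has square \<open>1\<close> and represents a common tangent object.
  For \<open>k = 0\<close>, \<open>w\<close> is an isotropic Lorentz vector, that is, a point sphere, or the point at infinity,
  which lies on no hypersphere.\<close>
lemma isotropic_orthogonal_cases:
  fixes c :: "'m \<Rightarrow> 'a::euclidean_space"
  assumes r: "\<And>i. 0 < r i" and e: "\<And>i. e i \<in> {1, -1 :: real}"
    and v: "v \<noteq> 0" "lie v v = 0" "\<And>i. lie (lie_vec (c i) (r i) (e i)) v = 0"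
  shows "(\<exists>w. lor w w = 1 \<and> (\<forall>i. \<bar>lor (sphere_vec (c i) (r i)) w\<bar> = 1)) \<or>
    (\<exists>p. \<forall>i. p \<in> sphere (c i) (r i))"
proof -
  obtain w k where vwk: "v = (w, k)" by (metis prod.collapse)
  have s: "lor (sphere_vec (c i) (r i)) w = e i * k" for i
    using v(3) r e by (simp only: vwk lie_lie_vec_eq_0)
  have ww: "lor w w = k * k" using v(2) by (simp add: vwk lie_def)
  show ?thesis
  proof (cases "k = 0")
    case False
    have "\<bar>e i\<bar> = 1" for i using e[of i] by auto
    then have "lor ((1 / k) *\<^sub>R w) ((1 / k) *\<^sub>R w) = 1"
      "\<bar>lor (sphere_vec (c i) (r i)) ((1 / k) *\<^sub>R w)\<bar> = 1" for i
      using False by (simp_all add: s lor_scaleR_right lor_scaleR_left ww abs_mult)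
    then show ?thesis by blast
  next
    case True
    obtain a q b where w: "w = (a, q, b)" by (metis prod_cases3)
    have bb: "b \<bullet> b = a * q" using ww True by (simp add: w lor_def)
    have "a \<noteq> 0"
    proof
      assume "a = 0"
      \<comment> \<open>A vector with only the coordinate \<open>q\<close> is the point at infinity.\<close>
      then have "b = 0" using bb by simp
      moreover have "q = 0"
        using s[of undefined] True \<open>a = 0\<close> \<open>b = 0\<close> r[of undefined]
        by (simp add: w lor_def sphere_vec_def)
      ultimately show False using v(1) True \<open>a = 0\<close> by (simp add: vwk w zero_prod_def)
    qed
    define p where "p = b /\<^sub>R a"
    have "w = a *\<^sub>R (1, p \<bullet> p, p)" using \<open>a \<noteq> 0\<close> by (simp add: w p_def bb)
    then have "lor (sphere_vec (c i) (r i)) (1, p \<bullet> p, p) = 0" for i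
      using s[of i] True \<open>a \<noteq> 0\<close> by (simp only: lor_scaleR_right) simp
    then show ?thesis using mem_sphere_iff_lor[OF r] by blast
  qed
qed

lemma linear_scaled_dual: "linear (\<lambda>v. - 2 *\<^sub>R dual v)"
  by (intro linear_compose_scale_right linear_dual)

lemma tau_matrix_eq_gram:
  fixes c :: "'m::finite \<Rightarrow> 'a::euclidean_space"
  assumes r: "\<And>i. 0 < r i" and e: "\<And>i. e i \<in> {1, -1}"
  shows "(\<chi> i j. tau (c i, r i, e i) (c j, r j, e j)) = ((\<chi> i j.
    lie_vec (c i) (r i) (e i) \<bullet> (- 2 *\<^sub>R dual (lie_vec (c j) (r j) (e j)))) :: real ^ 'm ^ 'm)"
  by (simp add: vec_eq_iff inner_dual tau_eq_lie[OF r r e e])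

lemma lie_self_lie_vec:
  assumes "0 < r" "e \<in> {1, -1}"
  shows "lie (lie_vec c r e) (lie_vec c r e) = 0"
  using tau_eq_lie[OF assms(1,1,2,2), of c c] assms(2) by (auto simp: tau_def)

text \<open>Normalising \<open>t\<close> and the Lorentz part \<open>w0\<close> of \<open>u = (w0, k0)\<close> gives the two objects. Positivity of \<open>u\<close>
  says that \<open>k0\<^sup>2 < lor w0 w0\<close>, so the common inclination \<open>\<bar>k0\<bar> / sqrt (lor w0 w0)\<close> is less than \<open>1\<close>.\<close>
lemma positive_pair_to_pencil:
  fixes c :: "'m \<Rightarrow> 'a::euclidean_space"
  assumes r: "\<And>i. 0 < r i" and e: "\<And>i. e i \<in> {1, -1 :: real}"
    and t: "snd t = 0" "0 < lie t t" "\<And>i. lie (lie_vec (c i) (r i) (e i)) t = 0"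
    and u: "0 < lie u u" "\<And>i. lie (lie_vec (c i) (r i) (e i)) u = 0"
    and tu: "lie t u = 0"
  shows "\<exists>v w k. lor v v = 1 \<and> lor w w = 1 \<and> lor v w = 0 \<and> 0 \<le> k \<and> k < 1 \<and>
    (\<forall>i. lor (sphere_vec (c i) (r i)) v = 0 \<and> \<bar>lor (sphere_vec (c i) (r i)) w\<bar> = k)"
proof -
  obtain v0 where tv: "t = (v0, 0)" using t(1) by (metis prod.collapse)
  obtain w0 k0 where uw: "u = (w0, k0)" by (metis prod.collapse)
  have v0: "0 < lor v0 v0" "lor (sphere_vec (c i) (r i)) v0 = 0" for i
    using t(2) lie_lie_vec_eq_0[OF r e, of "c i" i i v0 0] t(3) by (simp_all add: tv lie_def)
  have w0: "k0\<^sup>2 < lor w0 w0" "lor (sphere_vec (c i) (r i)) w0 = e i * k0" for i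
    using u(1) lie_lie_vec_eq_0[OF r e, of "c i" i i w0 k0] u(2)
    by (simp_all add: uw lie_def power2_eq_square)
  have vw0: "lor v0 w0 = 0" using tu by (simp add: tv uw lie_def)
  define M where "M = sqrt (lor v0 v0)"
  define N where "N = sqrt (lor w0 w0)"
  have "0 \<le> k0\<^sup>2" by simp
  then have w0pos: "0 < lor w0 w0" using w0(1) by linarith
  have M: "0 < M" "lor v0 v0 = M * M" using v0(1) by (simp_all add: M_def)
  have N: "0 < N" "lor w0 w0 = N * N" using w0pos by (simp_all add: N_def)
  have kN: "\<bar>k0\<bar> < N" using w0(1) by (simp add: N_def real_less_rsqrt)
  let ?v = "(1 / M) *\<^sub>R v0" and ?w = "(1 / N) *\<^sub>R w0"
  have "\<bar>e i\<bar> = 1" for i using e[of i] by auto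
  then have "\<bar>lor (sphere_vec (c i) (r i)) ?w\<bar> = \<bar>k0\<bar> / N" for i
    using N(1) by (simp add: lor_scaleR_right w0(2) abs_mult)
  moreover have "lor (sphere_vec (c i) (r i)) ?v = 0" for i by (simp add: lor_scaleR_right v0(2))
  moreover have "lor ?v ?v = 1" "lor ?w ?w = 1" "lor ?v ?w = 0"
    using M N by (simp_all add: lor_scaleR_right lor_scaleR_left vw0)
  moreover have "0 \<le> \<bar>k0\<bar> / N" "\<bar>k0\<bar> / N < 1" using N(1) kN by simp_all
  ultimately show ?thesis by blast
qed

text \<open>Here \<open>lor v w = 0\<close> stands in for the distinctness of the two loci, which follows from it by
  \<open>locus_eq_imp_lor\<close> below.\<close>
lemma det_tau_eq_0_imp:
  fixes c :: "'m::finite \<Rightarrow> 'a::euclidean_space"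
  assumes card: "CARD('m) = DIM('a) + 2"
    and r: "\<And>i. 0 < r i" and e: "\<And>i. e i \<in> {1, -1}"
    and det: "det ((\<chi> i j. tau (c i, r i, e i) (c j, r j, e j)) :: real ^ 'm ^ 'm) = 0"
  shows "(\<exists>w. lor w w = 1 \<and> (\<forall>i. \<bar>lor (sphere_vec (c i) (r i)) w\<bar> = 1)) \<or>
    (\<exists>p. \<forall>i. p \<in> sphere (c i) (r i)) \<or>
    (\<exists>v w k. lor v v = 1 \<and> lor w w = 1 \<and> lor v w = 0 \<and> 0 \<le> k \<and> k < 1 \<and>
      (\<forall>i. lor (sphere_vec (c i) (r i)) v = 0 \<and> \<bar>lor (sphere_vec (c i) (r i)) w\<bar> = k))"
proof -
  define x where "x i = lie_vec (c i) (r i) (e i)" for i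
  note alternatives = isotropic_orthogonal_cases[where c = c and r = r and e = e, OF r e, folded x_def]
    positive_pair_to_pencil[where c = c and r = r and e = e, OF r e, folded x_def]
  have "det ((\<chi> i j. x i \<bullet> (- 2 *\<^sub>R dual (x j))) :: real ^ 'm ^ 'm) = 0"
    using det unfolding tau_matrix_eq_gram[OF r e] x_def .
  from singular_gram_cases[OF linear_scaled_dual this] show ?thesis
  proof
    assume "\<exists>v. v \<noteq> 0 \<and> v \<bullet> (- 2 *\<^sub>R dual v) = 0 \<and> (\<forall>i. x i \<bullet> (- 2 *\<^sub>R dual v) = 0)"
    then obtain v where "v \<noteq> 0" "lie v v = 0" "\<And>i. lie (x i) v = 0" by (auto simp: inner_dual)
    then show ?thesis using alternatives(1)[of v] by blast
  next
    assume "dim (range x) < CARD('m)"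
    then have "dim (range x) < DIM('a) + 2" using card by simp
    moreover have "lie (x undefined) (x undefined) = 0" "snd (x undefined) \<noteq> 0"
      using lie_self_lie_vec[OF r e] r[of undefined] by (simp_all add: x_def lie_vec_def)
    ultimately show ?thesis
      using isotropic_or_positive_pair[of x undefined] alternatives by blast
  qed
qed

lemma det_tau_eq_0_if_isotropic:
  fixes c :: "'m::finite \<Rightarrow> 'a::euclidean_space"
  assumes card: "CARD('m) = DIM('a) + 2"
    and r: "\<And>i. 0 < r i" and e: "\<And>i. e i \<in> {1, -1}"
    and v: "(v, k) \<noteq> 0" "lor v v = k * k" "\<And>i. lor (sphere_vec (c i) (r i)) v = e i * k"
  shows "det ((\<chi> i j. tau (c i, r i, e i) (c j, r j, e j)) :: real ^ 'm ^ 'm) = 0"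
  unfolding tau_matrix_eq_gram[OF r e]
proof (rule singular_gram_if_isotropic[OF linear_scaled_dual])
  show "inj (\<lambda>v. - 2 *\<^sub>R dual v)" using inj_dual by (auto simp: inj_def)
  show "(v, k) \<noteq> 0" by fact
  show "(v, k) \<bullet> (- 2 *\<^sub>R dual (v, k)) = 0" using v(2) by (simp add: inner_dual lie_def)
  show "lie_vec (c i) (r i) (e i) \<bullet> (- 2 *\<^sub>R dual (v, k)) = 0" for i
    using v(3)[of i] lie_lie_vec_eq_0[OF r e, of "c i" i i] by (simp add: inner_dual)
qed (use card lie_commute in \<open>simp_all add: inner_dual\<close>)

lemma det_tau_eq_0_if_pencil:
  fixes c :: "'m::finite \<Rightarrow> 'a::euclidean_space"
  assumes card: "CARD('m) = DIM('a) + 2"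
    and r: "\<And>i. 0 < r i" and e: "\<And>i. e i \<in> {1, -1}"
    and v: "v \<noteq> 0" "\<And>i. lor (sphere_vec (c i) (r i)) v = 0"
    and w: "\<And>i. lor (sphere_vec (c i) (r i)) w = e i * k" "\<And>m. w \<noteq> m *\<^sub>R v"
  shows "det ((\<chi> i j. tau (c i, r i, e i) (c j, r j, e j)) :: real ^ 'm ^ 'm) = 0"
  unfolding tau_matrix_eq_gram[OF r e]
proof (rule singular_gram_if_dependent[OF linear_scaled_dual],
    rule dependent_if_two_normals[where a = "dual (v, 0)" and b = "dual (w, k)"])
  have "(v, 0) \<noteq> 0" using v(1) by (simp add: zero_prod_def)
  then show "dual (v, 0) \<noteq> 0" using linear_injective_0[OF linear_dual] inj_dual by metis
  show "dual (v, 0) \<bullet> lie_vec (c i) (r i) (e i) = 0" for i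
    using v(2) lie_lie_vec_eq_0[OF r e, of "c i" i i] by (subst inner_commute) (simp add: inner_dual)
  show "dual (w, k) \<bullet> lie_vec (c i) (r i) (e i) = 0" for i
    using w(1) lie_lie_vec_eq_0[OF r e, of "c i" i i] by (subst inner_commute) (simp add: inner_dual)
  show "dual (w, k) \<noteq> m *\<^sub>R dual (v, 0)" for m
  proof
    assume "dual (w, k) = m *\<^sub>R dual (v, 0)"
    then have "dual (w, k) = dual (m *\<^sub>R (v, 0))" by (simp only: linear_cmul[OF linear_dual])
    then have "(w, k) = m *\<^sub>R (v, 0)" using inj_dual by (rule injD[rotated])
    then show False using w(2) by simp
  qed
qed (use card in simp)

lemma locus_eq_imp_lor:
  fixes v :: "real \<times> real \<times> 'a::euclidean_space"
  assumes dim: "2 \<le> DIM('a)" and v: "lor v v = 1" "lor w w = 1" "locus v = locus w"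
    and p: "p \<in> locus v"
  shows "\<bar>lor v w\<bar> = 1"
proof -
  have "unit_normal_at (locus w) p (normal v p)"
    using unit_normal_locus[OF dim v(1)] v(3) p by metis
  then have "normal v p = normal w p \<or> normal v p = - normal w p"
    using unit_normal_locus[OF dim v(2)] by blast
  then show ?thesis
    using inner_normal_normal[of p v w] inner_normal_normal[of p w w] p v by auto
qed

section \<open>The characterisation\<close>

theorem corollaryD:
  fixes S :: "'m::finite \<Rightarrow> (real ^ 'n::finite) set"
    and c :: "'m \<Rightarrow> real ^ 'n"
    and r :: "'m \<Rightarrow> real"
  assumes "CARD('n) \<ge> 2"
    and "CARD('m) = CARD('n) + 2"
    and "\<And>i. 0 < r i"
    and "\<And>i. S i = sphere (c i) (r i)"
  shows "(\<exists>\<epsilon> :: 'm \<Rightarrow> real. (\<forall>i. \<epsilon> i \<in> {1, -1}) \<and>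
            det ((\<chi> i j. tau (c i, r i, \<epsilon> i) (c j, r j, \<epsilon> j)) :: real ^ 'm ^ 'm) = 0)
    \<longleftrightarrow>
      (\<exists>T. (hypersphere T \<or> hyperplane T) \<and> (\<forall>i. tangent (S i) T \<or> S i = T)) \<or>
      (\<exists>p. \<forall>i. p \<in> S i) \<or>
      (\<exists>T U. (hypersphere T \<or> hyperplane T) \<and> (hypersphere U \<or> hyperplane U) \<and> T \<noteq> U \<and>
             (\<forall>i. orthogonal_to (S i) T) \<and> equally_inclined S U)"
    (is "?det \<longleftrightarrow> ?tangent \<or> ?point \<or> ?pencil")
proof -
  note r = assms(3)
  have dim: "2 \<le> DIM(real ^ 'n)" and card: "CARD('m) = DIM(real ^ 'n) + 2"
    using assms(1,2) by simp_all
  have S: "S = (\<lambda>i. sphere (c i) (r i))" using assms(4) by blast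
  let ?L = "\<lambda>i. lor (sphere_vec (c i) (r i))"
  have tangent: "?tangent \<longleftrightarrow> (\<exists>v. lor v v = 1 \<and> (\<forall>i. \<bar>?L i v\<bar> = 1))"
  proof -
    have "?tangent \<longleftrightarrow> (\<exists>v. lor v v = 1 \<and> (\<forall>i. tangent (S i) (locus v) \<or> S i = locus v))"
      unfolding hypersphere_or_hyperplane_iff by blast
    also have "\<dots> \<longleftrightarrow> (\<exists>v. lor v v = 1 \<and> (\<forall>i. \<bar>?L i v\<bar> = 1))"
      by (simp add: S tangent_or_eq_iff[OF dim r] cong: conj_cong)
    finally show ?thesis .
  qed
  have pencil: "?pencil \<longleftrightarrow> (\<exists>v w k. lor v v = 1 \<and> lor w w = 1 \<and> locus v \<noteq> locus w \<and>
      0 \<le> k \<and> k < 1 \<and> (\<forall>i. ?L i v = 0 \<and> \<bar>?L i w\<bar> = k))"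
  proof -
    have "?pencil \<longleftrightarrow> (\<exists>v w. lor v v = 1 \<and> lor w w = 1 \<and> locus v \<noteq> locus w \<and>
        (\<forall>i. orthogonal_to (S i) (locus v)) \<and> equally_inclined S (locus w))"
      unfolding hypersphere_or_hyperplane_iff by blast
    also have "\<dots> \<longleftrightarrow> (\<exists>v w. lor v v = 1 \<and> lor w w = 1 \<and> locus v \<noteq> locus w \<and>
        (\<forall>i. ?L i v = 0) \<and> (\<exists>k. 0 \<le> k \<and> k < 1 \<and> (\<forall>i. \<bar>?L i w\<bar> = k)))"
      by (simp add: S orthogonal_to_iff[OF dim r] equally_inclined_iff[OF dim r] cong: conj_cong)
    also have "\<dots> \<longleftrightarrow> (\<exists>v w k. lor v v = 1 \<and> lor w w = 1 \<and> locus v \<noteq> locus w \<and>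
        0 \<le> k \<and> k < 1 \<and> (\<forall>i. ?L i v = 0 \<and> \<bar>?L i w\<bar> = k))" by blast
    finally show ?thesis .
  qed
  show ?thesis
  proof
    assume ?det
    then obtain e where e: "\<And>i. e i \<in> {1, -1}"
      and "det ((\<chi> i j. tau (c i, r i, e i) (c j, r j, e j)) :: real ^ 'm ^ 'm) = 0" by blast
    from det_tau_eq_0_imp[OF card r this]
    consider "\<exists>v. lor v v = 1 \<and> (\<forall>i. \<bar>?L i v\<bar> = 1)" | "\<exists>p. \<forall>i. p \<in> sphere (c i) (r i)"
      | "\<exists>v w k. lor v v = 1 \<and> lor w w = 1 \<and> lor v w = 0 \<and> 0 \<le> k \<and> k < 1 \<and>
          (\<forall>i. ?L i v = 0 \<and> \<bar>?L i w\<bar> = k)" by blast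
    then show "?tangent \<or> ?point \<or> ?pencil"
    proof cases
      case 1
      then have ?tangent by (simp only: tangent)
      then show ?thesis by (intro disjI1)
    next
      case 2
      then show ?thesis by (simp only: S simp_thms)
    next
      case 3
      then obtain v w k where vw: "lor v v = 1" "lor w w = 1" "lor v w = 0" and k: "0 \<le> k" "k < 1"
        and L: "\<And>i. ?L i v = 0" "\<And>i. \<bar>?L i w\<bar> = k" by blast
      obtain p where "p \<in> locus v"
        using sphere_meets_locus[OF dim r vw(1), of "c undefined" undefined] L(1) by auto
      then have "locus v \<noteq> locus w" using locus_eq_imp_lor[OF dim vw(1,2)] vw(3) by auto
      then have ?pencil unfolding pencil using vw k L by blast
      then show ?thesis by (intro disjI2)
    qed
  next
    have signs: "\<exists>e. (\<forall>i. e i \<in> {1, -1}) \<and> (\<forall>i. f i = e i * k)"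
      if "\<And>i. \<bar>f i\<bar> = k" for f :: "'m \<Rightarrow> real" and k
    proof (intro exI[of _ "\<lambda>i. if f i < 0 then -1 else 1"] conjI allI)
      show "f i = (if f i < 0 then - 1 else 1) * k" for i using that[of i] by auto
    qed simp
    assume "?tangent \<or> ?point \<or> ?pencil"
    then consider v where "lor v v = 1" "\<And>i. \<bar>?L i v\<bar> = 1" | p where "\<And>i. p \<in> S i"
      | v w k where "lor v v = 1" "lor w w = 1" "locus v \<noteq> locus w"
        "\<And>i. ?L i v = 0" "\<And>i. \<bar>?L i w\<bar> = k" unfolding tangent pencil by blast
    then show ?det
    proof cases
      case 1
      obtain e where e: "\<And>i. e i \<in> {1, -1}" "\<And>i. ?L i v = e i * 1"
        using signs[of "\<lambda>i. ?L i v" 1, OF 1(2)] by blast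
      have "(v, 1 :: real) \<noteq> 0" by (simp add: zero_prod_def)
      then have "det ((\<chi> i j. tau (c i, r i, e i) (c j, r j, e j)) :: real ^ 'm ^ 'm) = 0"
        by (rule det_tau_eq_0_if_isotropic[OF card r e(1) _ _ e(2)]) (simp add: 1(1))
      then show ?thesis using e(1) by blast
    next
      case 2
      let ?v = "(1 :: real, p \<bullet> p, p)"
      have "(?v, 0 :: real) \<noteq> 0" "lor ?v ?v = 0 * 0" by (simp_all add: zero_prod_def lor_def)
      moreover have "?L i ?v = 1 * 0" for i
        using 2[of i] mem_sphere_iff_lor[OF r, of p "c i" i] by (simp add: S)
      ultimately have "det ((\<chi> i j. tau (c i, r i, 1) (c j, r j, 1)) :: real ^ 'm ^ 'm) = 0"
        by (intro det_tau_eq_0_if_isotropic[OF card r, where e = "\<lambda>_. 1" and v = ?v and k = 0]) simp_all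
      then show ?thesis by (intro exI[of _ "\<lambda>_. 1"]) simp
    next
      case 3
      obtain e where e: "\<And>i. e i \<in> {1, -1}" "\<And>i. ?L i w = e i * k"
        using signs[of "\<lambda>i. ?L i w" k, OF 3(5)] by blast
      have "v \<noteq> 0" using 3(1) by (auto simp: lor_def zero_prod_def)
      moreover have "w \<noteq> m *\<^sub>R v" for m
      proof
        assume w: "w = m *\<^sub>R v"
        then have "m \<noteq> 0" using 3(2) by (auto simp: lor_def zero_prod_def)
        then show False using locus_scaleR 3(3) w by metis
      qed
      ultimately have "det ((\<chi> i j. tau (c i, r i, e i) (c j, r j, e j)) :: real ^ 'm ^ 'm) = 0"
        by (intro det_tau_eq_0_if_pencil[OF card r e(1) _ 3(4) e(2)])
      then show ?thesis using e(1) by blast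
    qed
  qed
qed

end
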